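(* Let $X$ be a set. For every perfect map $f\colon\mathbb{V}^{\uparrow}(([0,1]^{\uparrow})^X)\to[0,1]^{\uparrow}$ there exist an at most countable set $Y$, a perfect map $s\colon([0,1]^{\uparrow})^Y\to[0,1]^{\uparrow}$ and a family $(h_y\colon([0,1]^{\uparrow})^X\to[0,1]^{\uparrow})_{y\in Y}$ of perfect maps such that $f=s\circ\langle\Box\circ\mathbb{V}^{\uparrow}h_y\rangle_{y\in Y}$.
   Context: A stably compact space is a $T_0$ space that is compact, locally compact, coherent (intersection of two compact saturated sets is compact) and well-filtered; a perfect map is a continuous map such that preimages of compact saturated sets are compact saturated. The order on such a space is the specialization order; $\uparrow$ denotes up-closure. $[0,1]^{\uparrow}$ is the set $[0,1]$ with the topology of Euclidean-open upsets, and $([0,1]^{\uparrow})^X$ carries the product topology (a stably compact space). For a stably compact $Z$, $\mathbb{V}^{\uparrow}Z$ is the set of compact saturated subsets of $Z$ with topology generated by $\{K\mid K\subseteq U\}$ ($U$ open), and $\mathbb{V}^{\uparrow}h(K)=\uparrow h[K]$. $\Box\colon\mathbb{V}^{\uparrow}([0,1]^{\uparrow})\to[0,1]^{\uparrow}$ is $A\mapsto\inf A$ (with $\inf\varnothing=1$). $\langle g_y\rangle_{y\in Y}$ denotes the induced map into the product. *)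

theory Defs
  imports "HOL-Analysis.Analysis"
begin

definition spec_le :: "'a topology \<Rightarrow> 'a \<Rightarrow> 'a \<Rightarrow> bool" where
  "spec_le T x y \<longleftrightarrow> x \<in> topspace T \<and> y \<in> topspace T \<and>
     (\<forall>U. openin T U \<longrightarrow> x \<in> U \<longrightarrow> y \<in> U)"

definition saturated_in :: "'a topology \<Rightarrow> 'a set \<Rightarrow> bool" where
  "saturated_in T K \<longleftrightarrow> K \<subseteq> topspace T \<and> (\<forall>x\<in>K. \<forall>y. spec_le T x y \<longrightarrow> y \<in> K)"

definition compact_saturated_in :: "'a topology \<Rightarrow> 'a set \<Rightarrow> bool" where
  "compact_saturated_in T K \<longleftrightarrow> compactin T K \<and> saturated_in T K"

definition sc_perfect_map :: "'a topology \<Rightarrow> 'b topology \<Rightarrow> ('a \<Rightarrow> 'b) \<Rightarrow> bool" where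
  "sc_perfect_map S T f \<longleftrightarrow> continuous_map S T f \<and>
     (\<forall>K. compact_saturated_in T K \<longrightarrow>
        compact_saturated_in S {x \<in> topspace S. f x \<in> K})"

definition upper_unit :: "real topology" where
  "upper_unit = topology (\<lambda>U. openin (top_of_set {0..1}) U \<and>
      (\<forall>x\<in>U. \<forall>y\<in>{0..1}. x \<le> y \<longrightarrow> y \<in> U))"

definition upper_vietoris :: "'a topology \<Rightarrow> 'a set topology" where
  "upper_vietoris T = topology_generated_by
     ((\<lambda>U. {K. compact_saturated_in T K \<and> K \<subseteq> U}) ` {U. openin T U})"

definition upper_vietoris_map :: "'b topology \<Rightarrow> ('a \<Rightarrow> 'b) \<Rightarrow> 'a set \<Rightarrow> 'b set" where
  "upper_vietoris_map T h K = {z. \<exists>x\<in>K. spec_le T (h x) z}"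

definition box_inf :: "real set \<Rightarrow> real" where
  "box_inf A = (if A = {} then 1 else Inf A)"

end

(*
  A map between cubes that is monotone and continuous for the Euclidean topologies is perfect for
  the upper topologies, so all perfect maps needed here are built as Euclidean ones.
  For a < b the set {f >= b} is compact and {f > a} is an open neighbourhood of it, hence a union
  of sets of the form {K. K <= U}.  A Urysohn argument in the cube and compactness yield finitely
  many monotone continuous h such that some inf h[K] is at least 1/2 if f K >= b, and all of them
  vanish if f K <= a.  Taking a = i/2^n and b = (i+1)/2^n for all n and i gives a countable family
  (h_y), and averaging the truncated sums of the corresponding coordinates gives monotone continuous
  functions on the cube over Y that approximate f up to 2^-n along K |-> (inf h_y[K])_y.  A clamped
  version of this sequence converges uniformly on the whole cube, and its limit is s.
*)

theory Submission
  imports Defs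
begin

section \<open>Cubes with the upper and the Euclidean topology, and monotone continuous functions on
  them\<close>

abbreviation upper_cube :: "'a set \<Rightarrow> ('a \<Rightarrow> real) topology" where
  "upper_cube I \<equiv> product_topology (\<lambda>_. upper_unit) I"

abbreviation euclidean_cube :: "'a set \<Rightarrow> ('a \<Rightarrow> real) topology" where
  "euclidean_cube I \<equiv> product_topology (\<lambda>_. top_of_set {0..1}) I"

text \<open>Values are arbitrary reals, so that sums, multiples and shifts stay in the class; the
  range {0..1} is asked for only where perfectness is concluded.\<close>

definition mono_cont_on_cube :: "'a set \<Rightarrow> (('a \<Rightarrow> real) \<Rightarrow> real) \<Rightarrow> bool" where
  "mono_cont_on_cube I g \<longleftrightarrow>
     continuous_map (euclidean_cube I) euclideanreal g \<and>
     (\<forall>x\<in>topspace (euclidean_cube I). \<forall>y\<in>topspace (euclidean_cube I).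
        (\<forall>i\<in>I. x i \<le> y i) \<longrightarrow> g x \<le> g y)"

section \<open>The upper unit interval: open sets, specialization order, compact saturated
  sets\<close>

lemma openin_upper_unit:
  "openin upper_unit U \<longleftrightarrow>
     openin (top_of_set {0..1}) U \<and> (\<forall>x\<in>U. \<forall>y\<in>{0..1}. x \<le> y \<longrightarrow> y \<in> U)"
proof -
  have "istopology (\<lambda>U. openin (top_of_set {0..1::real}) U \<and>
      (\<forall>x\<in>U. \<forall>y\<in>{0..1}. x \<le> y \<longrightarrow> y \<in> U))"
    unfolding istopology_def by (auto 4 3)
  then show ?thesis
    by (simp add: upper_unit_def)
qed

lemma topspace_upper_unit [simp]: "topspace upper_unit = {0..1}"
proof -
  have "openin upper_unit {0..1}"
    by (auto simp: openin_upper_unit)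
  moreover have "U \<subseteq> {0..1}" if "openin upper_unit U" for U
    using that openin_subset[of "top_of_set {0..1}" U] by (simp add: openin_upper_unit)
  ultimately show ?thesis
    by (metis openin_subset openin_topspace subset_antisym)
qed

lemma openin_upper_unit_ray: "openin upper_unit ({0..1} \<inter> {t<..})"
  unfolding openin_upper_unit by (auto intro: openin_open_Int)

lemma spec_le_refl: "x \<in> topspace T \<Longrightarrow> spec_le T x x"
  by (simp add: spec_le_def)

lemma spec_le_upper_unit_imp_le: "spec_le upper_unit x y \<Longrightarrow> x \<le> y"
proof (rule ccontr)
  assume le: "spec_le upper_unit x y" and "\<not> x \<le> y"
  then have "x \<in> {0..1} \<inter> {y<..}"
    by (simp add: spec_le_def)
  then have "y \<in> {0..1} \<inter> {y<..}"
    using le openin_upper_unit_ray unfolding spec_le_def by blast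
  then show False by simp
qed

lemma spec_le_continuous_map:
  assumes "continuous_map S T f" "spec_le S x y"
  shows "spec_le T (f x) (f y)"
  unfolding spec_le_def
proof (intro conjI allI impI)
  show "f x \<in> topspace T" "f y \<in> topspace T"
    using assms by (auto simp: spec_le_def continuous_map_def)
  fix U assume U: "openin T U" "f x \<in> U"
  then have "openin S {z \<in> topspace S. f z \<in> U}"
    using assms by (auto intro: openin_continuous_map_preimage)
  then show "f y \<in> U"
    using assms U unfolding spec_le_def by blast
qed

lemma spec_le_upper_cube_imp_le:
  assumes "spec_le (upper_cube I) x y" "i \<in> I"
  shows "x i \<le> y i"
  using spec_le_continuous_map[OF continuous_map_product_projection assms(1)] assms(2)
    spec_le_upper_unit_imp_le by blast

lemma continuous_map_id_upper_unit: "continuous_map (top_of_set {0..1}) upper_unit id"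
  unfolding continuous_map_def
proof (intro conjI allI impI)
  fix U assume U: "openin upper_unit U"
  then have "{x \<in> topspace (top_of_set {0..1}). id x \<in> U} = U"
    using openin_subset[OF U] by auto
  then show "openin (top_of_set {0..1}) {x \<in> topspace (top_of_set {0..1}). id x \<in> U}"
    using U by (simp add: openin_upper_unit)
qed simp

text \<open>The Euclidean topology is finer, so Euclidean compactness of the interval carries over.
  For \<open>b > 1\<close> the set is empty.\<close>

lemma compact_saturated_in_upper_unit_atLeastAtMost:
  assumes "0 \<le> b"
  shows "compact_saturated_in upper_unit {b..1}"
  unfolding compact_saturated_in_def saturated_in_def
proof (intro conjI ballI allI impI)
  have "compactin (top_of_set {0..1}) {b..1}"
    using assms by (auto simp: compactin_subtopology)
  then show "compactin upper_unit {b..1}"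
    using image_compactin[OF _ continuous_map_id_upper_unit] by fastforce
  show "{b..1} \<subseteq> topspace upper_unit"
    using assms by auto
  fix x y assume "x \<in> {b..1}" "spec_le upper_unit x y"
  then show "y \<in> {b..1}"
    using spec_le_upper_unit_imp_le[of x y] by (auto simp: spec_le_def)
qed

text \<open>Compactness makes the infimum attained: otherwise the open rays \<open>{t<..}\<close>
  with \<open>m < t\<close> would cover \<open>C\<close>, and a finite subcover would yield a lower
  bound \<open>Min A\<close> strictly above the infimum.\<close>

lemma compact_saturated_in_upper_unitD:
  assumes C: "compact_saturated_in upper_unit C" and "C \<noteq> {}"
  obtains m where "0 \<le> m" "C = {m..1}"
proof -
  define m where "m = Inf C"
  have sub: "C \<subseteq> {0..1}" and comp: "compactin upper_unit C"
    using C by (auto simp: compact_saturated_in_def saturated_in_def)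
  \<comment> \<open>Open sets of \<open>upper_unit\<close> are upsets, so \<open>x \<le> y\<close>
    within the interval implies \<open>spec_le\<close>; saturation then makes \<open>C\<close> an
    upset.\<close>
  have up: "y \<in> C" if "x \<in> C" "y \<in> {0..1}" "x \<le> y" for x y
    using C that sub unfolding compact_saturated_in_def saturated_in_def spec_le_def
    by (auto simp: openin_upper_unit)
  have bdd: "bdd_below C"
    using sub by (meson atLeastAtMost_iff bdd_belowI subset_iff)
  have m_le: "m \<le> x" if "x \<in> C" for x
    unfolding m_def using that bdd by (rule cInf_lower)
  have m_in: "m \<in> C"
  proof (rule ccontr)
    assume "m \<notin> C"
    let ?R = "\<lambda>t. {0..1} \<inter> {t<..} :: real set"
    have "C \<subseteq> \<Union> (?R ` {m<..})"
    proof
      fix x assume "x \<in> C"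
      then have "m < x"
        using m_le \<open>m \<notin> C\<close> by (metis order_le_less)
      then obtain t where "m < t" "t < x"
        using dense by blast
      then show "x \<in> \<Union> (?R ` {m<..})"
        using \<open>x \<in> C\<close> sub by auto
    qed
    moreover have "\<forall>U\<in>?R ` {m<..}. openin upper_unit U"
      using openin_upper_unit_ray by blast
    ultimately obtain \<F> where \<F>: "finite \<F>" "\<F> \<subseteq> ?R ` {m<..}" "C \<subseteq> \<Union>\<F>"
      using comp unfolding compactin_def by meson
    then obtain A where A: "finite A" "A \<subseteq> {m<..}" "\<F> = ?R ` A"
      by (metis finite_subset_image)
    have "A \<noteq> {}"
      using A \<F>(3) \<open>C \<noteq> {}\<close> by auto
    then have "m < Min A"
      using A by auto
    moreover have "Min A \<le> x" if x: "x \<in> C" for x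
    proof -
      obtain t where "t \<in> A" "t < x"
        using x \<F>(3) A(3) by blast
      then show ?thesis
        using Min_le[OF A(1)] by fastforce
    qed
    then have "Min A \<le> m"
      unfolding m_def using \<open>C \<noteq> {}\<close> by (intro cInf_greatest)
    ultimately show False by simp
  qed
  show ?thesis
  proof
    show "0 \<le> m"
      using m_in sub by auto
    show "C = {m..1}"
    proof
      show "C \<subseteq> {m..1}"
        using sub m_le by auto
      show "{m..1} \<subseteq> C"
        using up[OF m_in] m_in sub by auto
    qed
  qed
qed

section \<open>Comparison of the two cube topologies and a criterion for perfectness\<close>

text \<open>Around each point take a Euclidean basic box inside \<open>W\<close> and replace every
  side \<open>V i\<close> by its up-closure \<open>U i\<close>. Each point of the larger box
  dominates a point of the smaller one, so it stays in the upset \<open>W\<close>.\<close>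

lemma openin_upper_cube_if_upset:
  assumes W: "openin (euclidean_cube I) W"
    and up: "\<And>x y. x \<in> W \<Longrightarrow> y \<in> topspace (euclidean_cube I) \<Longrightarrow> (\<And>i. i \<in> I \<Longrightarrow> x i \<le> y i) \<Longrightarrow> y \<in> W"
  shows "openin (upper_cube I) W"
  unfolding openin_product_topology_alt
proof
  fix x assume "x \<in> W"
  with W have "\<exists>V. finite {i \<in> I. V i \<noteq> topspace (top_of_set {0..1})} \<and>
      (\<forall>i\<in>I. openin (top_of_set {0..1}) (V i)) \<and> x \<in> Pi\<^sub>E I V \<and> Pi\<^sub>E I V \<subseteq> W"
    unfolding openin_product_topology_alt by (rule bspec)
  then obtain V where V: "finite {i \<in> I. V i \<noteq> topspace (top_of_set {0..1})}"
      "\<And>i. i \<in> I \<Longrightarrow> openin (top_of_set {0..1}) (V i)" "x \<in> Pi\<^sub>E I V" "Pi\<^sub>E I V \<subseteq> W"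
    by auto
  define U where "U i = {z \<in> {0..1}. \<exists>v\<in>V i. v \<le> z}" for i
  have Vsub: "V i \<subseteq> {0..1}" if "i \<in> I" for i
    using openin_subset[OF V(2)[OF that]] by simp
  \<comment> \<open>The up-closure is \<open>V i\<close> together with the open rays above its
    points, hence Euclidean open.\<close>
  have "U i = V i \<union> (\<Union>v\<in>V i. {0..1} \<inter> {v<..})" if "i \<in> I" for i
    using Vsub[OF that] unfolding U_def order_le_less greaterThan_def by blast
  then have "openin (top_of_set {0..1}) (U i)" if "i \<in> I" for i
    using V(2) that by (auto intro!: openin_Un openin_Union openin_open_Int)
  moreover have "y \<in> U i" if "x \<in> U i" "y \<in> {0..1}" "x \<le> y" for i x y
    using that unfolding U_def by (auto intro: order_trans)
  ultimately have U_open: "openin upper_unit (U i)" if "i \<in> I" for i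
    using that unfolding openin_upper_unit by blast
  \<comment> \<open>A side that is the full interval remains full, so only finitely many coordinates
    are restricted.\<close>
  have "{i \<in> I. U i \<noteq> topspace upper_unit} \<subseteq> {i \<in> I. V i \<noteq> topspace (top_of_set {0..1})}"
    unfolding U_def by auto
  then have "finite {i \<in> I. U i \<noteq> topspace upper_unit}"
    using V(1) finite_subset by blast
  moreover have "x \<in> Pi\<^sub>E I U"
    using V(3) Vsub unfolding U_def PiE_iff by blast
  moreover have "Pi\<^sub>E I U \<subseteq> W"
  proof
    fix y assume y: "y \<in> Pi\<^sub>E I U"
    then have "\<forall>i\<in>I. \<exists>v\<in>V i. v \<le> y i"
      unfolding U_def by (auto simp: PiE_iff)
    then obtain v where v: "\<And>i. i \<in> I \<Longrightarrow> v i \<in> V i \<and> v i \<le> y i"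
      by metis
    then have "(\<lambda>i\<in>I. v i) \<in> W"
      using V(4) by auto
    moreover have "y \<in> topspace (euclidean_cube I)"
      using y unfolding U_def by (auto simp: PiE_iff)
    ultimately show "y \<in> W"
      using up v by fastforce
  qed
  ultimately show "\<exists>U. finite {i \<in> I. U i \<noteq> topspace upper_unit} \<and>
      (\<forall>i\<in>I. openin upper_unit (U i)) \<and> x \<in> Pi\<^sub>E I U \<and> Pi\<^sub>E I U \<subseteq> W"
    using U_open by blast
qed

lemma topspace_upper_cube: "topspace (upper_cube I) = topspace (euclidean_cube I)"
  by simp

text \<open>By Tychonoff \<open>C\<close> is compact in the Euclidean cube, and the identity into
  the coarser upper cube is continuous.\<close>

lemma compactin_upper_cube_if_closedin:
  assumes "closedin (euclidean_cube I) C"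
  shows "compactin (upper_cube I) C"
proof -
  have "compact_space (euclidean_cube I)"
    by (simp add: compact_space_product_topology compact_space_subtopology)
  then have C: "compactin (euclidean_cube I) C"
    using assms closedin_compact_space by blast
  have "continuous_map (euclidean_cube I) (upper_cube I) (\<lambda>x. x)"
    unfolding continuous_map_componentwise
  proof (intro conjI ballI)
    fix i assume "i \<in> I"
    then have "continuous_map (euclidean_cube I) upper_unit (id \<circ> (\<lambda>x. x i))"
      using continuous_map_compose continuous_map_product_projection continuous_map_id_upper_unit
      by metis
    then show "continuous_map (euclidean_cube I) upper_unit (\<lambda>x. x i)"
      by (simp add: comp_def)
  qed (auto simp: PiE_iff)
  from image_compactin[OF C this] show ?thesis
    by simp
qed

text \<open>Preimages of open upsets are Euclidean open upsets. A nonempty compact saturated set is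
  some \<open>{m..1}\<close>, so its preimage is Euclidean closed, hence compact, and is saturated
  by monotonicity.\<close>

lemma sc_perfect_map_if_mono_cont_on_cube:
  assumes g: "mono_cont_on_cube I g"
    and range: "\<And>x. x \<in> topspace (euclidean_cube I) \<Longrightarrow> g x \<in> {0..1}"
  shows "sc_perfect_map (upper_cube I) upper_unit g"
proof -
  have cont: "continuous_map (euclidean_cube I) euclideanreal g"
    and mono: "\<And>x y. x \<in> topspace (euclidean_cube I) \<Longrightarrow> y \<in> topspace (euclidean_cube I) \<Longrightarrow>
        (\<And>i. i \<in> I \<Longrightarrow> x i \<le> y i) \<Longrightarrow> g x \<le> g y"
    using g unfolding mono_cont_on_cube_def by blast+
  have cont01: "continuous_map (euclidean_cube I) (top_of_set {0..1}) g"
    using cont range by (auto simp: continuous_map_in_subtopology)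
  have "continuous_map (upper_cube I) upper_unit g"
    unfolding continuous_map_def
  proof (intro conjI allI impI)
    show "g \<in> topspace (upper_cube I) \<rightarrow> topspace upper_unit"
      using range by auto
    fix U assume U: "openin upper_unit U"
    have "openin (euclidean_cube I) {x \<in> topspace (euclidean_cube I). g x \<in> U}"
      using cont01 U openin_continuous_map_preimage openin_upper_unit by blast
    moreover have "g y \<in> U" if "x \<in> topspace (euclidean_cube I)" "g x \<in> U"
      "y \<in> topspace (euclidean_cube I)" "\<And>i. i \<in> I \<Longrightarrow> x i \<le> y i" for x y
      using U mono[of x y] range[of y] that unfolding openin_upper_unit by blast
    ultimately show "openin (upper_cube I) {x \<in> topspace (upper_cube I). g x \<in> U}"
      unfolding topspace_upper_cube by (intro openin_upper_cube_if_upset) auto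
  qed
  moreover have "compact_saturated_in (upper_cube I) {x \<in> topspace (upper_cube I). g x \<in> C}"
    if C: "compact_saturated_in upper_unit C" for C
  proof -
    have "closedin euclideanreal C"
      using C compact_saturated_in_upper_unitD[of C] by (metis closed_atLeastAtMost closed_closedin closed_empty)
    then have "compactin (upper_cube I) {x \<in> topspace (upper_cube I). g x \<in> C}"
      using cont closedin_continuous_map_preimage compactin_upper_cube_if_closedin
      unfolding topspace_upper_cube by blast
    moreover have "saturated_in (upper_cube I) {x \<in> topspace (upper_cube I). g x \<in> C}"
      unfolding saturated_in_def
    proof (intro conjI ballI allI impI)
      fix x y assume x: "x \<in> {x \<in> topspace (upper_cube I). g x \<in> C}" and xy: "spec_le (upper_cube I) x y"
      then have y: "y \<in> topspace (upper_cube I)"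
        by (simp add: spec_le_def)
      then have "g x \<le> g y" "g y \<le> 1"
        using mono[of x y] x spec_le_upper_cube_imp_le[OF xy] range[of y]
        unfolding topspace_upper_cube by auto
      moreover obtain m where "C = {m..1}"
        using x C compact_saturated_in_upper_unitD[of C] by blast
      ultimately show "y \<in> {x \<in> topspace (upper_cube I). g x \<in> C}"
        using x y by simp
    qed blast
    ultimately show ?thesis
      by (simp add: compact_saturated_in_def)
  qed
  ultimately show ?thesis
    by (simp add: sc_perfect_map_def)
qed

section \<open>Closure properties of monotone continuous functions, including uniform limits\<close>

lemma mono_cont_on_cube_monoD:
  assumes "mono_cont_on_cube I g" "x \<in> topspace (euclidean_cube I)" "y \<in> topspace (euclidean_cube I)"
    and "\<And>i. i \<in> I \<Longrightarrow> x i \<le> y i"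
  shows "g x \<le> g y"
  using assms unfolding mono_cont_on_cube_def by blast

lemma mono_cont_on_cube_projection:
  assumes "i \<in> I"
  shows "mono_cont_on_cube I (\<lambda>x. x i)"
proof -
  have "continuous_map (euclidean_cube I) (top_of_set {0..1}) (\<lambda>x. x i)"
    using assms by (rule continuous_map_product_projection)
  then show ?thesis
    using assms by (auto simp: mono_cont_on_cube_def continuous_map_in_subtopology)
qed

lemma mono_cont_on_cube_compose:
  assumes "mono_cont_on_cube I g" "continuous_on UNIV \<phi>" "mono \<phi>"
  shows "mono_cont_on_cube I (\<lambda>x. \<phi> (g x))"
proof -
  have "continuous_map (euclidean_cube I) euclideanreal (\<phi> \<circ> g)"
    using assms by (auto simp: mono_cont_on_cube_def intro: continuous_map_compose)
  then show ?thesis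
    using assms by (auto simp: mono_cont_on_cube_def comp_def mono_def)
qed

lemma mono_cont_on_cube_sum:
  assumes "finite A" "\<And>a. a \<in> A \<Longrightarrow> mono_cont_on_cube I (g a)"
  shows "mono_cont_on_cube I (\<lambda>x. \<Sum>a\<in>A. g a x)"
  using assms unfolding mono_cont_on_cube_def
  by (auto intro!: continuous_map_sum sum_mono)

lemma mono_cont_on_cube_prod:
  assumes "finite A" "\<And>a. a \<in> A \<Longrightarrow> mono_cont_on_cube I (g a)"
    and "\<And>a x. a \<in> A \<Longrightarrow> x \<in> topspace (euclidean_cube I) \<Longrightarrow> 0 \<le> g a x"
  shows "mono_cont_on_cube I (\<lambda>x. \<Prod>a\<in>A. g a x)"
  using assms unfolding mono_cont_on_cube_def
  by (auto intro!: continuous_map_prod prod_mono)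

lemma mono_cont_on_cube_max:
  assumes "mono_cont_on_cube I g" "mono_cont_on_cube I h"
  shows "mono_cont_on_cube I (\<lambda>x. max (g x) (h x))"
proof -
  have "continuous_map (euclidean_cube I) euclideanreal (\<lambda>x. max (g x) (h x))"
    using assms by (auto simp: mono_cont_on_cube_def intro: continuous_map_real_max)
  then show ?thesis
    using assms unfolding mono_cont_on_cube_def by (meson max.mono)
qed

lemma mono_cont_on_cube_min:
  assumes "mono_cont_on_cube I g" "mono_cont_on_cube I h"
  shows "mono_cont_on_cube I (\<lambda>x. min (g x) (h x))"
proof -
  have "continuous_map (euclidean_cube I) euclideanreal (\<lambda>x. min (g x) (h x))"
    using assms by (auto simp: mono_cont_on_cube_def intro: continuous_map_real_min)
  then show ?thesis
    using assms unfolding mono_cont_on_cube_def by (meson min.mono)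
qed

lemma mono_cont_on_cube_uniform_limit:
  assumes g: "\<And>n. mono_cont_on_cube I (g n)"
    and lim: "uniform_limit (topspace (euclidean_cube I)) g l sequentially"
  shows "mono_cont_on_cube I l"
  unfolding mono_cont_on_cube_def
proof (intro conjI ballI impI)
  have "continuous_map (euclidean_cube I) Met_TC.mtopology l"
  proof (rule Met_TC.continuous_map_uniform_limit[where F = sequentially and f = g])
    show "\<forall>\<^sub>F n in sequentially. continuous_map (euclidean_cube I) Met_TC.mtopology (g n)"
      using g by (simp add: mono_cont_on_cube_def)
    show "\<forall>\<^sub>F n in sequentially. \<forall>x\<in>topspace (euclidean_cube I). l x \<in> UNIV \<and> dist (g n x) (l x) < \<epsilon>"
      if "0 < \<epsilon>" for \<epsilon>
      using uniform_limitD[OF lim that] by simp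
  qed simp
  then show "continuous_map (euclidean_cube I) euclideanreal l"
    by simp
next
  fix x y assume x: "x \<in> topspace (euclidean_cube I)" and y: "y \<in> topspace (euclidean_cube I)"
    and le: "\<forall>i\<in>I. x i \<le> y i"
  show "l x \<le> l y"
  proof (rule LIMSEQ_le)
    show "(\<lambda>n. g n x) \<longlonglongrightarrow> l x" "(\<lambda>n. g n y) \<longlonglongrightarrow> l y"
      using tendsto_uniform_limitI[OF lim] x y by blast+
    show "\<exists>N. \<forall>n\<ge>N. g n x \<le> g n y"
      using mono_cont_on_cube_monoD[OF g x y] le by blast
  qed
qed

text \<open>The sequence \<open>s n\<close> need not converge off \<open>p ` C\<close>. Clamping each term to a
  small neighbourhood of its predecessor forces uniform convergence everywhere and changes nothing
  on \<open>p ` C\<close>.\<close>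

lemma mono_cont_on_cube_extend_limit:
  assumes s: "\<And>n. mono_cont_on_cube I (s n)"
    and approx: "\<And>n c. c \<in> C \<Longrightarrow> \<bar>s n (p c) - F c\<bar> \<le> (1/2)^n"
    and p: "p ` C \<subseteq> topspace (euclidean_cube I)"
  obtains l where "mono_cont_on_cube I l" "\<And>c. c \<in> C \<Longrightarrow> l (p c) = F c"
proof -
  \<comment> \<open>On the image of \<open>p\<close> consecutive terms differ by at most
    \<open>(1/2)^n + (1/2)^(n+1)\<close>, which is below \<open>2 * (1/2)^n\<close>; so the clamp is
    inactive there, while the bounds remain summable.\<close>
  define \<epsilon> :: "nat \<Rightarrow> real" where "\<epsilon> n = 2 * (1/2)^n" for n
  define t where "t = rec_nat (s 0) (\<lambda>n u x. max (u x - \<epsilon> n) (min (u x + \<epsilon> n) (s (Suc n) x)))"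
  have t_0: "t 0 = s 0"
    and t_Suc: "t (Suc n) = (\<lambda>x. max (t n x - \<epsilon> n) (min (t n x + \<epsilon> n) (s (Suc n) x)))" for n
    by (simp_all add: t_def)
  have \<epsilon>_pos: "0 < \<epsilon> n" for n
    by (simp add: \<epsilon>_def)
  have t: "mono_cont_on_cube I (t n)" for n
  proof (induction n)
    case (Suc n)
    have "mono_cont_on_cube I (\<lambda>x. t n x - \<epsilon> n)" "mono_cont_on_cube I (\<lambda>x. t n x + \<epsilon> n)"
      by (intro mono_cont_on_cube_compose[OF Suc, of "\<lambda>r. r - \<epsilon> n"]
          mono_cont_on_cube_compose[OF Suc, of "\<lambda>r. r + \<epsilon> n"] continuous_intros;
          simp add: mono_def)+
    then show ?case
      unfolding t_Suc by (intro mono_cont_on_cube_max mono_cont_on_cube_min s)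
  qed (simp add: t_0 s)
  have t_on_C: "t n (p c) = s n (p c)" if "c \<in> C" for n c
  proof (induction n)
    case (Suc n)
    have "\<bar>s (Suc n) (p c) - s n (p c)\<bar> \<le> \<epsilon> n"
      using approx[OF that, of n] approx[OF that, of "Suc n"] zero_le_power[of "1/2::real" n]
      unfolding \<epsilon>_def power_Suc by linarith
    then show ?case
      unfolding t_Suc Suc by linarith
  qed (simp add: t_0)
  \<comment> \<open>The limit is obtained as \<open>t 0\<close> plus the series of increments, which
    the clamp bounds by \<open>\<epsilon> n\<close> everywhere, so the Weierstrass M-test
    applies.\<close>
  define d where "d n x = t (Suc n) x - t n x" for n x
  have d_le: "norm (d n x) \<le> \<epsilon> n" for n x
    unfolding real_norm_def d_def t_Suc using \<epsilon>_pos[of n] by linarith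
  have "summable \<epsilon>"
    unfolding \<epsilon>_def by (intro summable_mult summable_geometric) simp
  then have "uniform_limit (topspace (euclidean_cube I)) (\<lambda>n x. \<Sum>i<n. d i x) (\<lambda>x. \<Sum>i. d i x) sequentially"
    using d_le by (intro Weierstrass_m_test)
  then have "uniform_limit (topspace (euclidean_cube I)) (\<lambda>n x. (\<Sum>i<n. d i x) + t 0 x)
      (\<lambda>x. (\<Sum>i. d i x) + t 0 x) sequentially"
    by (intro uniform_limit_add uniform_limit_const)
  moreover have "(\<lambda>n x. (\<Sum>i<n. d i x) + t 0 x) = t"
    unfolding d_def using sum_lessThan_telescope[of "\<lambda>i. t i _"] by (intro ext) simp
  ultimately have lim: "uniform_limit (topspace (euclidean_cube I)) t (\<lambda>x. (\<Sum>i. d i x) + t 0 x) sequentially"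
    by simp
  show ?thesis
  proof
    show "mono_cont_on_cube I (\<lambda>x. (\<Sum>i. d i x) + t 0 x)"
      using t lim by (rule mono_cont_on_cube_uniform_limit)
    fix c assume c: "c \<in> C"
    then have "(\<lambda>n. s n (p c)) \<longlonglongrightarrow> (\<Sum>i. d i (p c)) + t 0 (p c)"
      using tendsto_uniform_limitI[OF lim, of "p c"] p c t_on_C by auto
    moreover have "(\<lambda>n. s n (p c) - F c) \<longlonglongrightarrow> 0"
    proof (rule Lim_null_comparison)
      show "\<forall>\<^sub>F n in sequentially. norm (s n (p c) - F c) \<le> (1/2)^n"
        using approx[OF c] by simp
    qed (simp add: LIMSEQ_realpow_zero)
    ultimately show "(\<Sum>i. d i (p c)) + t 0 (p c) = F c"
      using LIM_zero_cancel LIMSEQ_unique by metis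
  qed
qed

section \<open>Monotone bump and Urysohn functions for the upper topologies\<close>

text \<open>A ramp from 0 at \<open>v - \<epsilon>\<close> to 1 at \<open>v\<close> works:
  \<open>V\<close> contains everything above \<open>v\<close> and all points closer than
  \<open>\<epsilon>\<close> to \<open>v\<close>, so points outside \<open>V\<close> are at most
  \<open>v - \<epsilon>\<close>. The bound on \<open>range \<phi>\<close> holds on the whole line,
  so later range bounds need no membership in the cube.\<close>

lemma upper_unit_bump:
  assumes V: "openin upper_unit V" and v: "v \<in> V"
  obtains \<phi> :: "real \<Rightarrow> real" where "continuous_on UNIV \<phi>" "mono \<phi>" "range \<phi> \<subseteq> {0..1}"
    "\<phi> v = 1" "\<And>z. z \<in> {0..1} - V \<Longrightarrow> \<phi> z = 0"
proof -
  have "v \<in> {0..1}"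
    using openin_subset[OF V] v by auto
  have "openin (top_of_set {0..1}) V"
    using V by (simp add: openin_upper_unit)
  then obtain \<epsilon> where \<epsilon>: "0 < \<epsilon>" "\<And>z. z \<in> {0..1} \<Longrightarrow> dist z v < \<epsilon> \<Longrightarrow> z \<in> V"
    using v unfolding openin_euclidean_subtopology_iff by blast
  define \<phi> where "\<phi> z = max 0 (min 1 ((z - v + \<epsilon>) / \<epsilon>))" for z
  show ?thesis
  proof
    show "continuous_on UNIV \<phi>"
      unfolding \<phi>_def using \<epsilon>(1) by (intro continuous_intros) auto
    show "mono \<phi>"
      unfolding \<phi>_def using \<epsilon>(1)
      by (intro monoI max.mono min.mono divide_right_mono order_refl) auto
    show "range \<phi> \<subseteq> {0..1}" "\<phi> v = 1"
      unfolding \<phi>_def using \<epsilon>(1) by auto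
    fix z assume z: "z \<in> {0..1} - V"
    then have "\<not> v \<le> z"
      using V v unfolding openin_upper_unit by blast
    moreover have "\<not> dist z v < \<epsilon>"
      using \<epsilon>(2) z by blast
    ultimately have "z - v + \<epsilon> \<le> 0"
      by (simp add: dist_real_def)
    then show "\<phi> z = 0"
      unfolding \<phi>_def using \<epsilon>(1) divide_nonpos_pos[of "z - v + \<epsilon>" \<epsilon>] by linarith
  qed
qed

text \<open>Multiply one-dimensional bumps over the finitely many restricted coordinates of a basic
  box. A point of the cube outside the box violates one of these restrictions, which makes a factor
  vanish; nonnegative factors keep the product monotone.\<close>

lemma upper_cube_bump:
  assumes U: "openin (upper_cube I) U" and x: "x \<in> U"
  obtains g where "mono_cont_on_cube I g" "range g \<subseteq> {0..1}" "g x = 1"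
    "\<And>z. z \<in> topspace (upper_cube I) - U \<Longrightarrow> g z = 0"
proof -
  have "\<exists>V. finite {i \<in> I. V i \<noteq> topspace upper_unit} \<and>
      (\<forall>i\<in>I. openin upper_unit (V i)) \<and> x \<in> Pi\<^sub>E I V \<and> Pi\<^sub>E I V \<subseteq> U"
    using U x unfolding openin_product_topology_alt by (rule bspec)
  then obtain V where fin: "finite {i \<in> I. V i \<noteq> topspace upper_unit}"
    and V: "\<And>i. i \<in> I \<Longrightarrow> openin upper_unit (V i)" and xV: "x \<in> Pi\<^sub>E I V" and VU: "Pi\<^sub>E I V \<subseteq> U"
    by auto
  have "\<forall>i\<in>I. \<exists>\<phi>. continuous_on UNIV \<phi> \<and> mono \<phi> \<and> range \<phi> \<subseteq> {0..1} \<and> \<phi> (x i) = 1 \<and>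
      (\<forall>z\<in>{0..1} - V i. \<phi> z = (0::real))"
  proof
    fix i assume i: "i \<in> I"
    obtain \<phi> :: "real \<Rightarrow> real" where "continuous_on UNIV \<phi>" "mono \<phi>" "range \<phi> \<subseteq> {0..1}"
      "\<phi> (x i) = 1" "\<And>z. z \<in> {0..1} - V i \<Longrightarrow> \<phi> z = 0"
      using upper_unit_bump[OF V[OF i] PiE_mem[OF xV i]] by metis
    then show "\<exists>\<phi>. continuous_on UNIV \<phi> \<and> mono \<phi> \<and> range \<phi> \<subseteq> {0..1} \<and> \<phi> (x i) = 1 \<and>
      (\<forall>z\<in>{0..1} - V i. \<phi> z = (0::real))"
      by blast
  qed
  then obtain \<phi> where \<phi>: "\<And>i. i \<in> I \<Longrightarrow> continuous_on UNIV (\<phi> i)" "\<And>i. i \<in> I \<Longrightarrow> mono (\<phi> i)"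
      "\<And>i. i \<in> I \<Longrightarrow> range (\<phi> i) \<subseteq> {0..1}" "\<And>i. i \<in> I \<Longrightarrow> \<phi> i (x i) = 1"
      "\<And>i z. i \<in> I \<Longrightarrow> z \<in> {0..1} - V i \<Longrightarrow> \<phi> i z = (0::real)"
    unfolding bchoice_iff by blast
  define A where "A = {i \<in> I. V i \<noteq> topspace upper_unit}"
  have \<phi>01: "0 \<le> \<phi> i r \<and> \<phi> i r \<le> 1" if "i \<in> A" for i r
    using range_subsetD[OF \<phi>(3), of i r] that unfolding A_def by simp
  show ?thesis
  proof
    show "mono_cont_on_cube I (\<lambda>z. \<Prod>i\<in>A. \<phi> i (z i))"
    proof (rule mono_cont_on_cube_prod)
      show "finite A"
        using fin by (simp add: A_def)
      show "mono_cont_on_cube I (\<lambda>z. \<phi> i (z i))" if "i \<in> A" for i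
      proof -
        have "i \<in> I"
          using that by (simp add: A_def)
        then show ?thesis
          by (intro mono_cont_on_cube_compose[of I "\<lambda>z. z i" "\<phi> i"] mono_cont_on_cube_projection \<phi>)
      qed
    qed (use \<phi>01 in blast)
    show "range (\<lambda>z. \<Prod>i\<in>A. \<phi> i (z i)) \<subseteq> {0..1}"
      using \<phi>01 by (auto intro!: prod_nonneg prod_le_1)
    show "(\<Prod>i\<in>A. \<phi> i (x i)) = 1"
      using \<phi>(4) by (intro prod.neutral) (simp add: A_def)
    fix z assume z: "z \<in> topspace (upper_cube I) - U"
    then have "z \<notin> Pi\<^sub>E I V" "z \<in> Pi\<^sub>E I (\<lambda>_. {0..1})"
      using VU by auto
    then obtain i where i: "i \<in> I" "z i \<notin> V i" "z i \<in> {0..1}"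
      unfolding PiE_iff by blast
    then have "i \<in> A"
      unfolding A_def topspace_upper_unit by blast
    moreover have "\<phi> i (z i) = 0"
      using i \<phi>(5)[of i "z i"] by blast
    ultimately show "(\<Prod>i\<in>A. \<phi> i (z i)) = 0"
      using fin unfolding A_def by (intro prod_zero) blast+
  qed
qed

lemma openin_upper_cube_superlevel:
  assumes g: "mono_cont_on_cube I g"
  shows "openin (upper_cube I) {x \<in> topspace (upper_cube I). c < g x}"
  unfolding topspace_upper_cube
proof (rule openin_upper_cube_if_upset)
  have "openin (euclidean_cube I) {x \<in> topspace (euclidean_cube I). g x \<in> {c<..}}"
    using g by (intro openin_continuous_map_preimage[of _ euclideanreal]) (auto simp: mono_cont_on_cube_def)
  then show "openin (euclidean_cube I) {x \<in> topspace (euclidean_cube I). c < g x}"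
    by simp
  fix x y assume "x \<in> {x \<in> topspace (euclidean_cube I). c < g x}"
    "y \<in> topspace (euclidean_cube I)" "\<And>i. i \<in> I \<Longrightarrow> x i \<le> y i"
  then show "y \<in> {x \<in> topspace (euclidean_cube I). c < g x}"
    using mono_cont_on_cube_monoD[OF g, of x y] by auto
qed

text \<open>For nonnegative summands this is a monotone continuous form of disjunction. It is used
  with \<open>c = 1\<close> to merge bumps, and with \<open>c = 2\<close> to turn one coordinate of
  at least 1/2 into the value 1.\<close>

lemma mono_cont_on_cube_truncated_sum:
  assumes "finite A" "\<And>a. a \<in> A \<Longrightarrow> mono_cont_on_cube I (g a)" and "0 \<le> c"
  shows "mono_cont_on_cube I (\<lambda>x. min 1 (\<Sum>a\<in>A. c * g a x))"
proof -
  have "mono_cont_on_cube I (\<lambda>x. c * g a x)" if "a \<in> A" for a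
    using assms(2)[OF that] \<open>0 \<le> c\<close>
    by (intro mono_cont_on_cube_compose[of I "g a" "\<lambda>r. c * r"] continuous_intros)
      (auto simp: mono_def mult_left_mono)
  from mono_cont_on_cube_sum[OF assms(1) this]
  show ?thesis
    by (intro mono_cont_on_cube_compose[of I "\<lambda>x. \<Sum>a\<in>A. c * g a x" "min 1"] continuous_intros)
      (auto simp: mono_def)
qed

text \<open>Each point of \<open>K\<close> has a bump equal to 1 there and vanishing off
  \<open>U\<close>. The open sets where a bump exceeds 1/2 cover \<open>K\<close>, so finitely many
  suffice, and their truncated sum is \<open>g\<close>. The strict bound leaves an open
  neighbourhood of \<open>K\<close> on which it persists.\<close>

lemma upper_cube_Urysohn:
  assumes K: "compactin (upper_cube I) K" and U: "openin (upper_cube I) U" and "K \<subseteq> U"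
  obtains g where "mono_cont_on_cube I g" "range g \<subseteq> {0..1}" "\<And>x. x \<in> K \<Longrightarrow> 1/2 < g x"
    "\<And>z. z \<in> topspace (upper_cube I) - U \<Longrightarrow> g z = 0"
proof -
  have "\<forall>x\<in>K. \<exists>g. mono_cont_on_cube I g \<and> range g \<subseteq> {0..1} \<and> g x = 1 \<and>
      (\<forall>z\<in>topspace (upper_cube I) - U. g z = 0)"
  proof
    fix x assume "x \<in> K"
    then obtain g where "mono_cont_on_cube I g" "range g \<subseteq> {0..1}" "g x = 1"
      "\<And>z. z \<in> topspace (upper_cube I) - U \<Longrightarrow> g z = 0"
      using upper_cube_bump[OF U] \<open>K \<subseteq> U\<close> by (metis subsetD)
    then show "\<exists>g. mono_cont_on_cube I g \<and> range g \<subseteq> {0..1} \<and> g x = 1 \<and>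
      (\<forall>z\<in>topspace (upper_cube I) - U. g z = 0)"
      by blast
  qed
  then obtain g where g: "\<And>x. x \<in> K \<Longrightarrow> mono_cont_on_cube I (g x)" "\<And>x. x \<in> K \<Longrightarrow> range (g x) \<subseteq> {0..1}"
      "\<And>x. x \<in> K \<Longrightarrow> g x x = 1" "\<And>x z. x \<in> K \<Longrightarrow> z \<in> topspace (upper_cube I) - U \<Longrightarrow> g x z = 0"
    unfolding bchoice_iff by blast
  let ?W = "\<lambda>x. {z \<in> topspace (upper_cube I). 1/2 < g x z}"
  have "\<forall>W\<in>?W ` K. openin (upper_cube I) W"
    using openin_upper_cube_superlevel[OF g(1)] by blast
  moreover have "K \<subseteq> \<Union> (?W ` K)"
  proof
    fix x assume "x \<in> K"
    then have "x \<in> ?W x"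
      using g(3) compactin_subset_topspace[OF K] by auto
    then show "x \<in> \<Union> (?W ` K)"
      using \<open>x \<in> K\<close> by blast
  qed
  ultimately have "\<exists>\<F>. finite \<F> \<and> \<F> \<subseteq> ?W ` K \<and> K \<subseteq> \<Union>\<F>"
    using K unfolding compactin_def by simp
  then obtain \<F> where \<F>: "finite \<F>" "\<F> \<subseteq> ?W ` K" "K \<subseteq> \<Union>\<F>"
    by (elim exE conjE)
  obtain A where A: "A \<subseteq> K" "finite A" "\<F> = ?W ` A"
    using finite_subset_image[OF \<F>(1,2)] by (elim exE conjE)
  have nonneg: "0 \<le> g a z" if "a \<in> A" for a z
    using range_subsetD[OF g(2), of a z] that A(1) by auto
  show ?thesis
  proof
    show "mono_cont_on_cube I (\<lambda>z. min 1 (\<Sum>a\<in>A. 1 * g a z))"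
      using A g(1) by (intro mono_cont_on_cube_truncated_sum) auto
    show "range (\<lambda>z. min 1 (\<Sum>a\<in>A. 1 * g a z)) \<subseteq> {0..1}"
      using nonneg by (auto intro!: sum_nonneg)
    show "min 1 (\<Sum>a\<in>A. 1 * g a z) = 0" if "z \<in> topspace (upper_cube I) - U" for z
    proof -
      have "(\<Sum>a\<in>A. 1 * g a z) = 0"
        using g(4)[OF _ that] A(1) by (intro sum.neutral) auto
      then show ?thesis by simp
    qed
    fix x assume "x \<in> K"
    then obtain a where a: "a \<in> A" "1/2 < g a x"
      using \<F>(3) unfolding A(3) by blast
    moreover have "g a x \<le> (\<Sum>a\<in>A. g a x)"
      using A(2) a(1) nonneg by (intro member_le_sum) auto
    ultimately show "1/2 < min 1 (\<Sum>a\<in>A. 1 * g a x)"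
      by simp
  qed
qed

section \<open>Infima of \<open>h\<close> over \<open>K\<close> as coordinates of
  \<open>K\<close>\<close>

text \<open>The up-closure retains every \<open>h x\<close>, by reflexivity of
  \<open>spec_le\<close> on {0..1}; this is where the range hypothesis enters.\<close>

lemma box_inf_upper_vietoris_map_le:
  assumes "h ` K \<subseteq> {0..1}" "x \<in> K"
  shows "box_inf (upper_vietoris_map upper_unit h K) \<le> h x"
proof -
  have "h x \<in> upper_vietoris_map upper_unit h K"
    using assms spec_le_refl[of "h x" upper_unit]
    unfolding upper_vietoris_map_def topspace_upper_unit by blast
  moreover have "bdd_below (upper_vietoris_map upper_unit h K)"
    unfolding upper_vietoris_map_def spec_le_def by (intro bdd_belowI[of _ 0]) auto
  ultimately show ?thesis
    unfolding box_inf_def using cInf_lower by (metis empty_iff)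
qed

text \<open>The up-closure adds only points above some \<open>h x\<close>. The bound
  \<open>c \<le> 1\<close> covers an empty image, such as that of \<open>K = {}\<close>, where
  \<open>box_inf\<close> is 1.\<close>

lemma le_box_inf_upper_vietoris_map:
  assumes "\<And>x. x \<in> K \<Longrightarrow> c \<le> h x" "c \<le> 1"
  shows "c \<le> box_inf (upper_vietoris_map upper_unit h K)"
proof -
  have "c \<le> z" if "z \<in> upper_vietoris_map upper_unit h K" for z
    using that assms(1) spec_le_upper_unit_imp_le unfolding upper_vietoris_map_def
    by (blast intro: order_trans)
  then show ?thesis
    unfolding box_inf_def using assms(2) by (simp add: cInf_greatest)
qed

lemma box_inf_upper_vietoris_map_bounds:
  assumes "h ` K \<subseteq> {0..1}"
  shows "box_inf (upper_vietoris_map upper_unit h K) \<in> {0..1}"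
proof -
  have "0 \<le> box_inf (upper_vietoris_map upper_unit h K)"
    using assms by (intro le_box_inf_upper_vietoris_map) auto
  moreover have "box_inf (upper_vietoris_map upper_unit h K) \<le> 1"
  proof (cases "K = {}")
    case True
    then show ?thesis
      by (simp add: box_inf_def upper_vietoris_map_def)
  next
    case False
    then obtain x where "x \<in> K" by blast
    then show ?thesis
      using box_inf_upper_vietoris_map_le[OF assms, of x] assms by fastforce
  qed
  ultimately show ?thesis by simp
qed

section \<open>Open sets of the upper Vietoris space\<close>

text \<open>The generator for \<open>U = topspace T\<close> already contains every compact saturated
  set.\<close>

lemma topspace_upper_vietoris: "topspace (upper_vietoris T) = Collect (compact_saturated_in T)"
  unfolding upper_vietoris_def topology_generated_by_topspace compact_saturated_in_def
    saturated_in_def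
  using openin_topspace by blast

lemma openin_upper_vietoris_box:
  "openin T U \<Longrightarrow> openin (upper_vietoris T) {K. compact_saturated_in T K \<and> K \<subseteq> U}"
  unfolding upper_vietoris_def by (rule topology_generated_by_Basis) blast

text \<open>The generating sets form a base and not merely a subbase: those for \<open>U1\<close>
  and \<open>U2\<close> intersect in the one for \<open>U1 \<inter> U2\<close>.\<close>

lemma openin_upper_vietorisD:
  assumes "openin (upper_vietoris T) W" "K \<in> W"
  obtains U where "openin T U" "K \<subseteq> U" "\<And>L. compact_saturated_in T L \<Longrightarrow> L \<subseteq> U \<Longrightarrow> L \<in> W"
proof -
  define \<B> where "\<B> = (\<lambda>U. {K. compact_saturated_in T K \<and> K \<subseteq> U}) ` {U. openin T U}"
  have "generate_topology_on \<B> W"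
    using assms(1) by (simp add: upper_vietoris_def openin_topology_generated_by_iff \<B>_def)
  then have "\<forall>K\<in>W. \<exists>U. openin T U \<and> K \<subseteq> U \<and> (\<forall>L. compact_saturated_in T L \<longrightarrow> L \<subseteq> U \<longrightarrow> L \<in> W)"
  proof (induction rule: generate_topology_on.induct)
    case (Int W1 W2)
    show ?case
    proof
      fix K assume "K \<in> W1 \<inter> W2"
      then have K: "K \<in> W1" "K \<in> W2"
        by auto
      obtain U1 where U1: "openin T U1" "K \<subseteq> U1" "\<forall>L. compact_saturated_in T L \<longrightarrow> L \<subseteq> U1 \<longrightarrow> L \<in> W1"
        using bspec[OF Int.IH(1) K(1)] by (elim exE conjE)
      obtain U2 where U2: "openin T U2" "K \<subseteq> U2" "\<forall>L. compact_saturated_in T L \<longrightarrow> L \<subseteq> U2 \<longrightarrow> L \<in> W2"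
        using bspec[OF Int.IH(2) K(2)] by (elim exE conjE)
      have "openin T (U1 \<inter> U2) \<and> K \<subseteq> U1 \<inter> U2 \<and>
          (\<forall>L. compact_saturated_in T L \<longrightarrow> L \<subseteq> U1 \<inter> U2 \<longrightarrow> L \<in> W1 \<inter> W2)"
        using U1 U2 by (simp add: openin_Int le_infI1 le_infI2)
      then show "\<exists>U. openin T U \<and> K \<subseteq> U \<and> (\<forall>L. compact_saturated_in T L \<longrightarrow> L \<subseteq> U \<longrightarrow> L \<in> W1 \<inter> W2)" ..
    qed
  next
    case (UN \<W>)
    show ?case
    proof
      fix K assume "K \<in> \<Union>\<W>"
      then obtain W' where W': "W' \<in> \<W>" "K \<in> W'" ..
      then have "\<exists>U. openin T U \<and> K \<subseteq> U \<and> (\<forall>L. compact_saturated_in T L \<longrightarrow> L \<subseteq> U \<longrightarrow> L \<in> W')"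
        using bspec[OF UN.IH] by simp
      then show "\<exists>U. openin T U \<and> K \<subseteq> U \<and> (\<forall>L. compact_saturated_in T L \<longrightarrow> L \<subseteq> U \<longrightarrow> L \<in> \<Union>\<W>)"
        using W'(1) by blast
    qed
  next
    case (Basis W')
    then show ?case
      unfolding \<B>_def by blast
  qed simp
  then show ?thesis
    using assms(2) that by blast
qed

section \<open>Separation of the level sets of \<open>f\<close> by finitely many coordinates\<close>

text \<open>Compactness enters twice: inside each \<open>K\<close>, to find one \<open>h\<close>
  through \<open>upper_cube_Urysohn\<close>, and then on the set of all \<open>K\<close> with
  \<open>b \<le> f K\<close>, to retain finitely many. Nothing is claimed for
  \<open>a < f K < b\<close>.\<close>

lemma separate_by_box_inf:
  assumes f: "sc_perfect_map (upper_vietoris (upper_cube X)) upper_unit f" and "0 \<le> a" "a < b"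
  obtains H where "finite H" "\<And>h. h \<in> H \<Longrightarrow> mono_cont_on_cube X h \<and> range h \<subseteq> {0..1}"
    "\<And>K. K \<in> topspace (upper_vietoris (upper_cube X)) \<Longrightarrow> b \<le> f K \<Longrightarrow>
       \<exists>h\<in>H. 1/2 \<le> box_inf (upper_vietoris_map upper_unit h K)"
    "\<And>K h. K \<in> topspace (upper_vietoris (upper_cube X)) \<Longrightarrow> f K \<le> a \<Longrightarrow> h \<in> H \<Longrightarrow>
       box_inf (upper_vietoris_map upper_unit h K) = 0"
proof -
  let ?V = "upper_vietoris (upper_cube X)"
  let ?box = "\<lambda>h K. box_inf (upper_vietoris_map upper_unit h K)"
  \<comment> \<open>\<open>W\<close> is open by continuity of \<open>f\<close>, \<open>C\<close> is
    compact by perfectness, and \<open>a < b\<close> gives \<open>C \<subseteq> W\<close>.\<close>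
  define W where "W = {K \<in> topspace ?V. f K \<in> {0..1} \<inter> {a<..}}"
  define C where "C = {K \<in> topspace ?V. f K \<in> {b..1}}"
  have cont: "continuous_map ?V upper_unit f"
    and perf: "\<And>D. compact_saturated_in upper_unit D \<Longrightarrow>
      compact_saturated_in ?V {K \<in> topspace ?V. f K \<in> D}"
    using f unfolding sc_perfect_map_def by auto
  have f01: "f K \<in> {0..1}" if "K \<in> topspace ?V" for K
    using cont that by (auto simp: continuous_map_def)
  have "openin ?V W"
    unfolding W_def using cont openin_upper_unit_ray by (rule openin_continuous_map_preimage)
  have "compactin ?V C"
    unfolding C_def
    using perf[OF compact_saturated_in_upper_unit_atLeastAtMost[of b]] assms(2,3)
    by (simp add: compact_saturated_in_def)
  have subset: "K \<subseteq> topspace (upper_cube X)" if "K \<in> topspace ?V" for K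
    using that unfolding topspace_upper_vietoris compact_saturated_in_def saturated_in_def by blast
  have "\<forall>K\<in>C. \<exists>h. mono_cont_on_cube X h \<and> range h \<subseteq> {0..1} \<and> (\<forall>x\<in>K. 1/2 < h x) \<and>
      (\<forall>L\<in>topspace ?V. f L \<le> a \<longrightarrow> ?box h L = 0)"
  proof
    fix K assume "K \<in> C"
    then have "K \<in> W" and K: "compactin (upper_cube X) K"
      using f01 \<open>a < b\<close> unfolding C_def W_def topspace_upper_vietoris compact_saturated_in_def by auto
    obtain U where U: "openin (upper_cube X) U" "K \<subseteq> U"
      "\<And>L. compact_saturated_in (upper_cube X) L \<Longrightarrow> L \<subseteq> U \<Longrightarrow> L \<in> W"
      using openin_upper_vietorisD[OF \<open>openin ?V W\<close> \<open>K \<in> W\<close>] by blast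
    obtain h where h: "mono_cont_on_cube X h" "range h \<subseteq> {0..1}" "\<And>x. x \<in> K \<Longrightarrow> 1/2 < h x"
      "\<And>z. z \<in> topspace (upper_cube X) - U \<Longrightarrow> h z = 0"
      using upper_cube_Urysohn[OF K U(1,2)] by blast
    \<comment> \<open>A positive infimum would mean that \<open>h\<close> has no zero on
      \<open>L\<close>, so \<open>L \<subseteq> U\<close> and thus \<open>a < f L\<close>. The
      argument includes \<open>L = {}\<close>, whose infimum is 1.\<close>
    have "?box h L = 0" if L: "L \<in> topspace ?V" "f L \<le> a" for L
    proof (rule ccontr)
      have hL: "h ` L \<subseteq> {0..1}"
        using h(2) by blast
      assume "?box h L \<noteq> 0"
      then have "0 < ?box h L"
        using box_inf_upper_vietoris_map_bounds[OF hL] by simp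
      then have "h x \<noteq> 0" if "x \<in> L" for x
        using box_inf_upper_vietoris_map_le[OF hL that] by simp
      then have "L \<subseteq> U"
        using h(4) subset[OF L(1)] by blast
      then have "L \<in> W"
        using U(3) L(1) by (simp add: topspace_upper_vietoris)
      then show False
        using L(2) by (simp add: W_def)
    qed
    then show "\<exists>h. mono_cont_on_cube X h \<and> range h \<subseteq> {0..1} \<and> (\<forall>x\<in>K. 1/2 < h x) \<and>
      (\<forall>L\<in>topspace ?V. f L \<le> a \<longrightarrow> ?box h L = 0)"
      using h(1-3) by blast
  qed
  from bchoice[OF this] obtain h where h_C: "\<forall>K\<in>C. mono_cont_on_cube X (h K) \<and>
      range (h K) \<subseteq> {0..1} \<and> (\<forall>x\<in>K. 1/2 < h K x) \<and>
      (\<forall>L\<in>topspace ?V. f L \<le> a \<longrightarrow> ?box (h K) L = 0)" ..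
  have h: "mono_cont_on_cube X (h K)" "range (h K) \<subseteq> {0..1}" "x \<in> K \<Longrightarrow> 1/2 < h K x"
      "L \<in> topspace ?V \<Longrightarrow> f L \<le> a \<Longrightarrow> ?box (h K) L = 0" if "K \<in> C" for K x L
    using bspec[OF h_C that] by simp_all
  \<comment> \<open>\<open>?N K\<close> is a Vietoris-open neighbourhood of \<open>K\<close>, since
    \<open>h K\<close> exceeds 1/2 strictly on \<open>K\<close>; on every member of
    \<open>?N K\<close> the infimum of \<open>h K\<close> is at least 1/2.\<close>
  let ?N = "\<lambda>K. {L. compact_saturated_in (upper_cube X) L \<and>
      L \<subseteq> {x \<in> topspace (upper_cube X). 1/2 < h K x}}"
  have "\<forall>N\<in>?N ` C. openin ?V N"
    using openin_upper_vietoris_box[OF openin_upper_cube_superlevel[OF h(1)]] by blast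
  moreover have "C \<subseteq> \<Union> (?N ` C)"
  proof
    fix K assume K: "K \<in> C"
    then have "compact_saturated_in (upper_cube X) K" "K \<subseteq> topspace (upper_cube X)"
      using subset unfolding C_def topspace_upper_vietoris by blast+
    then have "K \<in> ?N K"
      using h(3)[OF K] by blast
    then show "K \<in> \<Union> (?N ` C)"
      using K by blast
  qed
  ultimately have "\<exists>\<F>. finite \<F> \<and> \<F> \<subseteq> ?N ` C \<and> C \<subseteq> \<Union>\<F>"
    using \<open>compactin ?V C\<close> unfolding compactin_def by simp
  then obtain \<F> where \<F>: "finite \<F>" "\<F> \<subseteq> ?N ` C" "C \<subseteq> \<Union>\<F>"
    by (elim exE conjE)
  obtain A where A: "A \<subseteq> C" "finite A" "\<F> = ?N ` A"
    using finite_subset_image[OF \<F>(1,2)] by (elim exE conjE)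
  show ?thesis
  proof
    show "finite (h ` A)"
      using A(2) by simp
    show "mono_cont_on_cube X g \<and> range g \<subseteq> {0..1}" if "g \<in> h ` A" for g
      using that h(1,2) A(1) by blast
    show "?box g K = 0" if "K \<in> topspace ?V" "f K \<le> a" "g \<in> h ` A" for K g
      using that h(4) A(1) by blast
    fix K assume "K \<in> topspace ?V" "b \<le> f K"
    then have "K \<in> C"
      using f01 by (simp add: C_def)
    then obtain a where a: "a \<in> A" "K \<in> ?N a"
      using \<F>(3) unfolding A(3) by blast
    then have "1/2 \<le> ?box (h a) K"
      by (intro le_box_inf_upper_vietoris_map) auto
    then show "\<exists>g\<in>h ` A. 1/2 \<le> ?box g K"
      using a(1) by blast
  qed
qed

section \<open>Approximation of a number by an average of threshold values\<close>

text \<open>With \<open>m\<close> the floor of \<open>n * r\<close>, the value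
  \<open>\<sigma> i\<close> is 1 for \<open>i < m\<close> and 0 for \<open>i > m\<close>. Only
  \<open>\<sigma> m\<close> is undetermined, so the sum lies between \<open>m\<close> and
  \<open>m + 1\<close>, as does \<open>n * r\<close>.\<close>

lemma abs_average_of_steps_le:
  fixes r :: real and n :: nat
  assumes r: "0 \<le> r" "r \<le> 1" and "0 < n"
    and one: "\<And>i. i < n \<Longrightarrow> real (Suc i) / n \<le> r \<Longrightarrow> \<sigma> i = 1"
    and zero: "\<And>i. i < n \<Longrightarrow> r \<le> real i / n \<Longrightarrow> \<sigma> i = 0"
    and bounds: "\<And>i. 0 \<le> \<sigma> i \<and> \<sigma> i \<le> 1"
  shows "\<bar>(\<Sum>i<n. \<sigma> i) / n - r\<bar> \<le> 1 / n"
proof -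
  define m where "m = nat \<lfloor>n * r\<rfloor>"
  have m: "real m \<le> n * r" "n * r < real m + 1"
    using r unfolding m_def by (simp_all add: of_nat_nat)
  have "n * r \<le> n"
    using r mult_left_le[of r "real n"] by simp
  then have "m \<le> n"
    using m by linarith
  have "real (card {..<m}) = (\<Sum>i<m. \<sigma> i)"
  proof -
    have "\<sigma> i = 1" if "i < m" for i
    proof (rule one)
      show "i < n"
        using that \<open>m \<le> n\<close> by simp
      have "real (Suc i) \<le> n * r"
        using that m(1) by linarith
      then show "real (Suc i) / n \<le> r"
        using \<open>0 < n\<close> by (simp add: divide_le_eq mult.commute)
    qed
    then show ?thesis by simp
  qed
  also have "\<dots> \<le> (\<Sum>i<n. \<sigma> i)"
    using \<open>m \<le> n\<close> bounds by (intro sum_mono2) auto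
  finally have lower: "real m \<le> (\<Sum>i<n. \<sigma> i)"
    by simp
  \<comment> \<open>For \<open>r = 1\<close> the floor is \<open>m = n\<close>, which is not an
    index of the sum; the intersection accounts for this.\<close>
  have "(\<Sum>i<n. \<sigma> i) = (\<Sum>i\<in>{..<n} \<inter> {..m}. \<sigma> i)"
  proof (rule sum.mono_neutral_right)
    show "\<forall>i\<in>{..<n} - {..<n} \<inter> {..m}. \<sigma> i = 0"
    proof
      fix i assume "i \<in> {..<n} - {..<n} \<inter> {..m}"
      then have "i < n" "Suc m \<le> i"
        by auto
      then have "n * r \<le> real i"
        using m(2) by linarith
      then show "\<sigma> i = 0"
        using \<open>i < n\<close> by (intro zero) (simp_all add: le_divide_eq mult.commute)
    qed
  qed auto
  also have "\<dots> \<le> (\<Sum>i\<le>m. \<sigma> i)"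
    using bounds by (intro sum_mono2) auto
  also have "\<dots> \<le> (\<Sum>i\<le>m. 1)"
    using bounds by (intro sum_mono) simp
  finally have upper: "(\<Sum>i<n. \<sigma> i) \<le> real m + 1"
    by simp
  have "\<bar>(\<Sum>i<n. \<sigma> i) - n * r\<bar> \<le> 1"
    using lower upper m by linarith
  moreover have "(\<Sum>i<n. \<sigma> i) / n - r = ((\<Sum>i<n. \<sigma> i) - n * r) / n"
    using \<open>0 < n\<close> by (simp add: field_simps)
  ultimately show ?thesis
    using \<open>0 < n\<close> by (simp add: abs_divide divide_right_mono)
qed

section \<open>The countable family of coordinates and the factorization of \<open>f\<close>\<close>

theorem theorem5p17:
  fixes X :: "'a set"
    and f :: "('a \<Rightarrow> real) set \<Rightarrow> real"
  assumes "sc_perfect_map (upper_vietoris (product_topology (\<lambda>_. upper_unit) X)) upper_unit f"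
  shows "\<exists>(Y :: nat set) (s :: (nat \<Rightarrow> real) \<Rightarrow> real) (h :: nat \<Rightarrow> ('a \<Rightarrow> real) \<Rightarrow> real).
           countable Y \<and>
           sc_perfect_map (product_topology (\<lambda>_. upper_unit) Y) upper_unit s \<and>
           (\<forall>y\<in>Y. sc_perfect_map (product_topology (\<lambda>_. upper_unit) X) upper_unit (h y)) \<and>
           (\<forall>K\<in>topspace (upper_vietoris (product_topology (\<lambda>_. upper_unit) X)).
              f K = s (\<lambda>y\<in>Y. box_inf (upper_vietoris_map upper_unit (h y) K)))"
proof -
  let ?V = "upper_vietoris (upper_cube X)"
  let ?box = "\<lambda>h K. box_inf (upper_vietoris_map upper_unit h K)"
  let ?good = "\<lambda>h. mono_cont_on_cube X h \<and> range h \<subseteq> {0..1::real}"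
  have f01: "f K \<in> {0..1}" if "K \<in> topspace ?V" for K
    using assms that by (auto simp: sc_perfect_map_def continuous_map_def)
  define separating where "separating n i H \<longleftrightarrow> finite H \<and> (\<forall>h\<in>H. ?good h) \<and>
      (\<forall>K\<in>topspace ?V. real (Suc i) / 2^n \<le> f K \<longrightarrow> (\<exists>h\<in>H. 1/2 \<le> ?box h K)) \<and>
      (\<forall>K\<in>topspace ?V. f K \<le> real i / 2^n \<longrightarrow> (\<forall>h\<in>H. ?box h K = 0))" for n i :: nat and H
  have "\<exists>H. separating n i H" for n i
  proof -
    have "0 \<le> real i / 2^n" "real i / 2^n < real (Suc i) / 2^n"
      by (simp_all add: divide_strict_right_mono)
    from separate_by_box_inf[OF assms this] show ?thesis
      unfolding separating_def by metis
  qed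
  then obtain H where H: "\<And>n i. separating n i (H n i)"
    by metis
  have H_fin: "finite (H n i)" and H_good: "h \<in> H n i \<Longrightarrow> ?good h" for n i h
    using H[of n i] unfolding separating_def by blast+
  have H_one: "\<exists>h\<in>H n i. 1/2 \<le> ?box h K"
    if "K \<in> topspace ?V" "real (Suc i) / 2^n \<le> f K" for n i K
    using H[of n i] that unfolding separating_def by blast
  have H_zero: "?box h K = 0"
    if "K \<in> topspace ?V" "f K \<le> real i / 2^n" "h \<in> H n i" for n i K h
    using H[of n i] that unfolding separating_def by blast
  \<comment> \<open>The zero function makes \<open>\<H>\<close> nonempty, so
    \<open>from_nat_into\<close> enumerates it by all natural numbers, with repetitions if
    necessary. Hence \<open>Y\<close> can be \<open>UNIV\<close>.\<close>
  define \<H> where "\<H> = insert (\<lambda>_. 0) (\<Union>n i. H n i)"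
  define h where "h = from_nat_into \<H>"
  have "countable \<H>"
    unfolding \<H>_def using H_fin by (simp add: countable_finite)
  then have range_h: "range h = \<H>"
    unfolding h_def by (intro range_from_nat_into) (auto simp: \<H>_def)
  have h_good: "?good (h j)" for j
  proof -
    have "?good (\<lambda>_. 0)"
      by (auto simp: mono_cont_on_cube_def)
    then have "\<forall>g\<in>\<H>. ?good g"
      unfolding \<H>_def using H_good by blast
    then show ?thesis
      using range_h by blast
  qed
  \<comment> \<open>As the enumeration may repeat, the full preimage of \<open>H n i\<close> can be
    infinite; a finite set of indices is chosen instead.\<close>
  have "\<exists>J. finite J \<and> h ` J = H n i" for n i
  proof -
    have "H n i \<subseteq> range h"
      unfolding range_h \<H>_def by auto
    from finite_subset_image[OF H_fin this] show ?thesis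
      by metis
  qed
  then obtain J where J: "\<And>n i. finite (J n i)" "\<And>n i. h ` J n i = H n i"
    by metis
  define p where "p K = (\<lambda>j. ?box (h j) K)" for K
  have p01: "p K j \<in> {0..1}" for K j
    unfolding p_def using h_good[of j] by (intro box_inf_upper_vietoris_map_bounds) blast
  \<comment> \<open>\<open>\<sigma> n i\<close> is a continuous threshold at level
    \<open>i / 2^n\<close>: at \<open>p K\<close> it is 0 if \<open>f K\<close> is at most this
    level, and 1 if \<open>f K\<close> reaches \<open>(i + 1) / 2^n\<close>, since doubling lifts a
    coordinate of at least 1/2 to 1. Then \<open>s n\<close> averages the \<open>2^n\<close>
    thresholds.\<close>
  define \<sigma> where "\<sigma> n i y = min 1 (\<Sum>j\<in>J n i. 2 * y j)" for n i and y :: "nat \<Rightarrow> real"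
  define s where "s n y = (1/2)^n * (\<Sum>i<2^n. \<sigma> n i y)" for n y
  have "mono_cont_on_cube UNIV (\<sigma> n i)" for n i
    unfolding \<sigma>_def
    by (intro mono_cont_on_cube_truncated_sum mono_cont_on_cube_projection J(1)) simp_all
  then have s: "mono_cont_on_cube UNIV (s n)" for n
    unfolding s_def
    by (intro mono_cont_on_cube_compose[of UNIV _ "\<lambda>r. (1/2)^n * r"] mono_cont_on_cube_sum continuous_intros)
      (auto simp: mono_def)
  have approx: "\<bar>s n (p K) - f K\<bar> \<le> (1/2)^n" if K: "K \<in> topspace ?V" for n K
  proof -
    have nonneg: "0 \<le> 2 * p K j" for j
      using p01[of K j] by simp
    \<comment> \<open>The cast matches the natural number of steps in
      \<open>abs_average_of_steps_le\<close>.\<close>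
    have "\<bar>(\<Sum>i<2^n. \<sigma> n i (p K)) / (2^n :: nat) - f K\<bar> \<le> 1 / (2^n :: nat)"
    proof (rule abs_average_of_steps_le)
      show "\<sigma> n i (p K) = 1" if "real (Suc i) / (2^n :: nat) \<le> f K" for i
      proof -
        have "\<exists>h\<in>h ` J n i. 1/2 \<le> ?box h K"
          using H_one[OF K, of i n] that J(2) by simp
        then obtain j where j: "j \<in> J n i" "1/2 \<le> p K j"
          by (auto simp: p_def)
        have "2 * p K j \<le> (\<Sum>j\<in>J n i. 2 * p K j)"
          using j(1) J(1) nonneg by (intro member_le_sum) auto
        then show ?thesis
          using j(2) by (simp add: \<sigma>_def)
      qed
      show "\<sigma> n i (p K) = 0" if "f K \<le> real i / (2^n :: nat)" for i
      proof -
        have "p K j = 0" if "j \<in> J n i" for j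
          using H_zero[OF K, of i n "h j"] \<open>f K \<le> _\<close> J(2) that by (auto simp: p_def)
        then show ?thesis
          by (simp add: \<sigma>_def)
      qed
      show "0 \<le> \<sigma> n i (p K) \<and> \<sigma> n i (p K) \<le> 1" for i
        unfolding \<sigma>_def using nonneg by (simp add: sum_nonneg)
    qed (use f01[OF K] in auto)
    then show ?thesis
      by (simp add: s_def power_one_over divide_simps)
  qed
  have "p K \<in> topspace (euclidean_cube UNIV)" for K
    using p01 unfolding topspace_product_topology by (intro PiE_I) simp_all
  then have "p ` topspace ?V \<subseteq> topspace (euclidean_cube UNIV)"
    by blast
  \<comment> \<open>The approximants are controlled only on the image of \<open>p\<close>; the limit
    is nevertheless monotone and continuous on the whole cube.\<close>
  from mono_cont_on_cube_extend_limit[where s = s and p = p and F = f, OF s approx this]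
  obtain l where l: "mono_cont_on_cube UNIV l" "\<And>K. K \<in> topspace ?V \<Longrightarrow> l (p K) = f K"
    by metis
  \<comment> \<open>Away from the image of \<open>p\<close> the limit \<open>l\<close> may leave the
    unit interval, so it is clamped. On the image it equals \<open>f K\<close>, which lies in
    {0..1}, and the clamp changes nothing.\<close>
  define s' where "s' y = max 0 (min 1 (l y))" for y
  have "mono_cont_on_cube UNIV s'"
    unfolding s'_def
    by (intro mono_cont_on_cube_compose[OF l(1), of "\<lambda>r. max 0 (min 1 r)"] continuous_intros)
      (auto simp: mono_def)
  then have "sc_perfect_map (upper_cube UNIV) upper_unit s'"
    by (rule sc_perfect_map_if_mono_cont_on_cube) (simp add: s'_def)
  moreover have "sc_perfect_map (upper_cube X) upper_unit (h j)" for j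
    using h_good[of j] by (intro sc_perfect_map_if_mono_cont_on_cube) blast+
  moreover have "f K = s' (\<lambda>j\<in>UNIV. ?box (h j) K)" if "K \<in> topspace ?V" for K
    using l(2)[OF that] f01[OF that] by (simp add: s'_def p_def restrict_def)
  ultimately show ?thesis
    by (intro exI[of _ UNIV] exI[of _ s'] exI[of _ h]) simp
qed

end
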